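(* Let $V:=\{p\in H^2(0,1)\,|\,p(0)=p'(1)=0\}$, equipped with the $H^2(0,1)$-norm, and let $H^{-2}(0,1):=V^*$ be its dual space with respect to the pivot space $L^2(0,1)$. Define $\mathcal{A}_{11}:V\to H^{-2}(0,1)$, $\mathcal{A}_{12}:L^2(0,1)\to H^{-2}(0,1)$ and $\mathcal{A}_{21}:V\to L^2(0,1)$ by $$\langle\mathcal{A}_{11}p_1,p_2\rangle=\langle p_1'',p_2''\rangle_{L^2(0,1)},\qquad \langle\mathcal{A}_{12}q,p_1\rangle=\langle q,p_1''\rangle_{L^2(0,1)},\qquad \langle\mathcal{A}_{21}p_1,q\rangle_{L^2(0,1)}=-\langle p_1'',q\rangle_{L^2(0,1)}$$ for all $p_1,p_2\in V$ and $q\in L^2(0,1)$, and consider the operator $$\mathcal{A}=\begin{bmatrix}\mathcal{A}_{11}&\mathcal{A}_{12}\\\mathcal{A}_{21}&0\end{bmatrix}$$ with associated Schur complement $$\mathcal{W}:=-\mathcal{A}_{21}\mathcal{A}_{11}^{-1}\mathcal{A}_{12}.$$ Then $\mathcal{W}$ is bounded, i.e. $\mathcal{W}\in L(L^2(0,1),L^2(0,1))$, and accretive.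
   Context: All function spaces are real. The pairing $\langle\cdot,\cdot\rangle$ without subscript is the duality pairing between $H^{-2}(0,1)=V^*$ and $V$. $\mathcal{A}_{11}^{-1}:H^{-2}(0,1)\to V$ denotes the inverse of $\mathcal{A}_{11}:V\to H^{-2}(0,1)$, which is an isomorphism, so $\mathcal{W}$ is well-defined on $L^2(0,1)$. $L(X,Y)$ is the space of bounded linear operators from $X$ to $Y$. An operator $\mathcal{T}$ on a Hilbert space is accretive if $\langle\mathcal{T}x,x\rangle\ge0$ for all $x$ in its domain. *)

theory Defs
  imports "HOL-Analysis.Analysis"
begin

abbreviation leb01 :: "real measure"
  where "leb01 \<equiv> lebesgue_on {0<..<1}"

definition square_integrable :: "(real \<Rightarrow> real) \<Rightarrow> bool"
  where "square_integrable f \<longleftrightarrow> f \<in> borel_measurable leb01 \<and> integrable leb01 (\<lambda>x. (f x)\<^sup>2)"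

lemma square_integrable_mult:
  assumes "square_integrable f" "square_integrable g"
  shows "integrable leb01 (\<lambda>x. f x * g x)"
proof (rule Bochner_Integration.integrable_bound)
  show "integrable leb01 (\<lambda>x. (f x)\<^sup>2 + (g x)\<^sup>2)"
    using assms by (auto simp: square_integrable_def)
  show "(\<lambda>x. f x * g x) \<in> borel_measurable leb01"
    using assms by (auto simp: square_integrable_def)
  have "\<bar>a * b\<bar> \<le> \<bar>a\<^sup>2 + b\<^sup>2\<bar>" for a b :: real
  proof -
    have "2 * \<bar>a\<bar> * \<bar>b\<bar> \<le> a\<^sup>2 + b\<^sup>2"
      using sum_squares_bound[of "\<bar>a\<bar>" "\<bar>b\<bar>"] by simp
    moreover have "0 \<le> \<bar>a\<bar> * \<bar>b\<bar>" by simp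
    ultimately show ?thesis unfolding abs_mult by linarith
  qed
  then show "AE x in leb01. norm (f x * g x) \<le> norm ((f x)\<^sup>2 + (g x)\<^sup>2)"
    by simp
qed

lemma square_integrable_bounded:
  assumes "g \<in> borel_measurable leb01" "\<And>x. \<bar>g x\<bar> \<le> B"
  shows "square_integrable g"
proof -
  have "integrable leb01 (\<lambda>x. (g x)\<^sup>2)"
  proof (rule Bochner_Integration.integrable_bound)
    show "integrable leb01 (\<lambda>x. B\<^sup>2)"
      by (rule finite_measure.integrable_const)
        (auto intro!: finite_measureI simp: emeasure_restrict_space)
    show "(\<lambda>x. (g x)\<^sup>2) \<in> borel_measurable leb01"
      using assms by simp
    show "AE x in leb01. norm ((g x)\<^sup>2) \<le> norm (B\<^sup>2)"
      using assms(2) by (auto intro!: AE_I2 simp: abs_le_square_iff[symmetric] intro: order_trans[OF _ abs_ge_self])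
  qed
  then show ?thesis
    using assms by (simp add: square_integrable_def)
qed

lemma square_integrable_add:
  assumes "square_integrable f" "square_integrable g"
  shows "square_integrable (\<lambda>x. f x + g x)"
proof -
  have "integrable leb01 (\<lambda>x. (f x)\<^sup>2 + (g x)\<^sup>2 + 2 * (f x * g x))"
    using assms square_integrable_mult[OF assms] by (auto simp: square_integrable_def)
  then show ?thesis
    using assms by (auto simp: square_integrable_def power2_sum mult.assoc)
qed

lemma square_integrable_scale:
  "square_integrable f \<Longrightarrow> square_integrable (\<lambda>x. c * f x)"
  by (auto simp: square_integrable_def power_mult_distrib)

lemma square_integrable_0: "square_integrable (\<lambda>x. 0)"
  by (simp add: square_integrable_def)

lemma square_integrable_imp_integrable:
  assumes "square_integrable f"
  shows "integrable leb01 f"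
  using square_integrable_mult[OF assms square_integrable_bounded[of "\<lambda>_. 1" 1]] by simp

definition l2_rel :: "(real \<Rightarrow> real) \<Rightarrow> (real \<Rightarrow> real) \<Rightarrow> bool"
  where "l2_rel f g \<longleftrightarrow> square_integrable f \<and> square_integrable g \<and> (AE x in leb01. f x = g x)"

quotient_type l2 = "real \<Rightarrow> real" / partial: l2_rel
proof (rule part_equivpI)
  show "\<exists>f. l2_rel f f"
    using square_integrable_0 by (auto simp: l2_rel_def)
  show "symp l2_rel"
    by (auto simp: symp_def l2_rel_def)
  show "transp l2_rel"
    by (auto simp: transp_def l2_rel_def)
qed

lemma l2_rel_measurable:
  assumes "l2_rel f g"
  shows "f \<in> borel_measurable leb01" "g \<in> borel_measurable leb01"
  using assms by (auto simp: l2_rel_def square_integrable_def)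

instantiation l2 :: real_inner
begin

lift_definition zero_l2 :: l2 is "\<lambda>x. 0"
  by (simp add: l2_rel_def square_integrable_0)

lift_definition plus_l2 :: "l2 \<Rightarrow> l2 \<Rightarrow> l2" is "\<lambda>f g x. f x + g x"
  by (auto simp: l2_rel_def intro: square_integrable_add)

lift_definition scaleR_l2 :: "real \<Rightarrow> l2 \<Rightarrow> l2" is "\<lambda>c f x. c * f x"
  by (auto simp: l2_rel_def intro: square_integrable_scale)

lift_definition inner_l2 :: "l2 \<Rightarrow> l2 \<Rightarrow> real" is "\<lambda>f g. LINT x|leb01. f x * g x"
proof -
  fix f f' g g' :: "real \<Rightarrow> real"
  assume fg: "l2_rel f f'" "l2_rel g g'"
  note [measurable] = fg[THEN l2_rel_measurable(1)] fg[THEN l2_rel_measurable(2)]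
  show "(LINT x|leb01. f x * g x) = (LINT x|leb01. f' x * g' x)"
    by (rule integral_cong_AE) (use fg in \<open>auto simp: l2_rel_def\<close>)
qed

definition uminus_l2 :: "l2 \<Rightarrow> l2" where "- p = (-1) *\<^sub>R p" for p :: l2
definition minus_l2 :: "l2 \<Rightarrow> l2 \<Rightarrow> l2" where "p - q = p + - q" for p q :: l2
definition norm_l2 :: "l2 \<Rightarrow> real" where "norm p = sqrt (inner p p)" for p :: l2
definition sgn_l2 :: "l2 \<Rightarrow> l2" where "sgn p = inverse (norm p) *\<^sub>R p" for p :: l2
definition dist_l2 :: "l2 \<Rightarrow> l2 \<Rightarrow> real" where "dist p q = norm (p - q)" for p q :: l2
definition uniformity_l2 :: "(l2 \<times> l2) filter"
  where "uniformity = (INF e\<in>{0<..}. principal {(x::l2, y). dist x y < e})"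
definition open_l2 :: "l2 set \<Rightarrow> bool"
  where "open U = (\<forall>x\<in>U. eventually (\<lambda>(x', y). x' = x \<longrightarrow> y \<in> U) uniformity)" for U :: "l2 set"

instance
proof
  fix p q r :: l2 and a b :: real and U :: "l2 set"
  show "p + q + r = p + (q + r)"
    by transfer (auto simp: l2_rel_def add.assoc intro!: square_integrable_add)
  show "p + q = q + p"
    by transfer (auto simp: l2_rel_def add.commute intro!: square_integrable_add)
  show "0 + p = p"
    by transfer (auto simp: l2_rel_def)
  show "- p + p = 0"
    unfolding uminus_l2_def
    by transfer (auto simp: l2_rel_def intro!: square_integrable_add square_integrable_scale square_integrable_0
        intro: square_integrable_scale[where c = "-1", simplified])
  show "p - q = p + - q"
    by (simp add: minus_l2_def)
  show "a *\<^sub>R (p + q) = a *\<^sub>R p + a *\<^sub>R q"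
    by transfer (auto simp: l2_rel_def distrib_left intro!: square_integrable_add square_integrable_scale)
  show "(a + b) *\<^sub>R p = a *\<^sub>R p + b *\<^sub>R p"
    by transfer (auto simp: l2_rel_def distrib_right intro!: square_integrable_add square_integrable_scale)
  show "a *\<^sub>R b *\<^sub>R p = (a * b) *\<^sub>R p"
    by transfer (auto simp: l2_rel_def mult.assoc[symmetric] intro!: square_integrable_scale)
  show "1 *\<^sub>R p = p"
    by transfer (auto simp: l2_rel_def)
  show "sgn p = inverse (norm p) *\<^sub>R p"
    by (simp add: sgn_l2_def)
  show "dist p q = norm (p - q)"
    by (simp add: dist_l2_def)
  show "uniformity = (INF e\<in>{0<..}. principal {(x::l2, y). dist x y < e})"
    by (simp add: uniformity_l2_def)
  show "open U = (\<forall>x\<in>U. eventually (\<lambda>(x', y). x' = x \<longrightarrow> y \<in> U) uniformity)"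
    by (simp add: open_l2_def)
  show "inner p q = inner q p"
    by transfer (simp add: mult.commute)
  show "inner (p + q) r = inner p r + inner q r"
    by transfer (auto simp: l2_rel_def distrib_right intro!: Bochner_Integration.integral_add square_integrable_mult)
  show "inner (a *\<^sub>R p) q = a * inner p q"
    by transfer (simp add: mult.assoc)
  show "0 \<le> inner p p"
    by transfer (auto intro: integral_nonneg_AE)
  show "inner p p = 0 \<longleftrightarrow> p = 0"
  proof transfer
    fix f :: "real \<Rightarrow> real"
    assume f: "l2_rel f f"
    have "(LINT x|leb01. f x * f x) = 0 \<longleftrightarrow> (AE x in leb01. f x * f x = 0)"
      by (rule integral_nonneg_eq_0_iff_AE)
        (use f square_integrable_mult in \<open>auto simp: l2_rel_def\<close>)
    then show "(LINT x|leb01. f x * f x) = 0 \<longleftrightarrow> l2_rel f (\<lambda>x. 0)"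
      using f by (simp add: l2_rel_def square_integrable_0)
  qed
  show "norm p = sqrt (inner p p)"
    by (simp add: norm_l2_def)
qed

end

definition test_function :: "(real \<Rightarrow> real) \<Rightarrow> bool"
  where "test_function \<phi> \<longleftrightarrow>
    (\<forall>n x. (deriv ^^ n) \<phi> differentiable at x) \<and>
    compact (closure {x. \<phi> x \<noteq> 0}) \<and> closure {x. \<phi> x \<noteq> 0} \<subseteq> {0<..<1}"

lemma smooth_coinduct:
  assumes "f \<in> S" and S: "\<And>f. f \<in> S \<Longrightarrow> \<exists>f'\<in>S. \<forall>x. (f has_real_derivative f' x) (at x)"
  shows "(deriv ^^ n) f \<in> S \<and> (\<forall>x. (deriv ^^ n) f differentiable at x)"
proof -
  have D: "deriv g \<in> S" if "g \<in> S" for g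
    using S[OF that] by (metis DERIV_imp_deriv ext)
  have d: "g differentiable at x" if "g \<in> S" for g x
    using S[OF that] by (auto simp: real_differentiable_def)
  have "(deriv ^^ n) f \<in> S"
    by (induction n) (auto simp: assms(1) D)
  then show ?thesis
    by (simp add: d)
qed

text \<open>Compositions of these functions with affine maps generate an algebra closed under
  differentiation, which provides enough test functions for the fundamental lemma of the calculus of
  variations. That lemma makes weak derivatives unique.\<close>

definition flat :: "real poly \<Rightarrow> real \<Rightarrow> real"
  where "flat P y = (if 0 < y then poly P (1 / y) * exp (- (1 / y)) else 0)"

lemma poly_exp_tendsto_0: "((\<lambda>z. poly P z * exp (- z)) \<longlongrightarrow> 0) at_top" for P :: "real poly"
proof -
  have "((\<lambda>z. \<Sum>i\<le>degree P. coeff P i * (z ^ i / exp z)) \<longlongrightarrow> (\<Sum>i\<le>degree P. coeff P i * 0)) at_top"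
    by (intro tendsto_intros tendsto_power_div_exp_0)
  then show ?thesis
    by (simp add: poly_altdef sum_distrib_right exp_minus divide_inverse mult.assoc)
qed

lemma DERIV_flat:
  "(flat P has_real_derivative flat (monom 1 2 * (P - pderiv P)) y) (at y)"
proof -
  consider "y > 0" | "y < 0" | "y = 0" by linarith
  then show ?thesis
  proof cases
    case 1
    have "((\<lambda>y. poly P (1 / y) * exp (- (1 / y))) has_real_derivative
        flat (monom 1 2 * (P - pderiv P)) y) (at y)"
      using 1 by (auto intro!: derivative_eq_intros DERIV_chain2[OF poly_DERIV]
          simp: flat_def poly_monom field_simps power2_eq_square)
    then show ?thesis
      by (rule has_field_derivative_transform_within_open[where S = "{0<..}"])
        (use 1 in \<open>auto simp: flat_def\<close>)
  next
    case 2
    have "((\<lambda>y. 0) has_real_derivative 0) (at y)" by simp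
    then have "(flat P has_real_derivative 0) (at y)"
      by (rule has_field_derivative_transform_within_open[where S = "{..<0}"])
        (use 2 in \<open>auto simp: flat_def\<close>)
    then show ?thesis
      using 2 by (simp add: flat_def)
  next
    case 3
    have "((\<lambda>h. flat P h / h) \<longlongrightarrow> 0) (at_right 0)"
    proof -
      have "((\<lambda>h. poly (pCons 0 P) (inverse h) * exp (- inverse h)) \<longlongrightarrow> 0) (at_right 0)"
        by (rule filterlim_compose[OF poly_exp_tendsto_0 filterlim_inverse_at_top_right])
      then show ?thesis
        by (rule Lim_transform_eventually)
          (auto simp: eventually_at_filter flat_def divide_inverse)
    qed
    moreover have "((\<lambda>h. flat P h / h) \<longlongrightarrow> 0) (at_left 0)"
    proof -
      have "((\<lambda>h. 0::real) \<longlongrightarrow> 0) (at_left 0)" by simp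
      then show ?thesis
        by (rule Lim_transform_eventually) (auto simp: eventually_at_filter flat_def)
    qed
    ultimately have "((\<lambda>h. flat P h / h) \<longlongrightarrow> 0) (at 0)"
      by (simp add: filterlim_split_at)
    then show ?thesis
      using 3 by (simp add: has_field_derivative_iff flat_def)
  qed
qed

inductive_set flats :: "(real \<Rightarrow> real) set"
  where
    base: "(\<lambda>x. flat P (c * x + d)) \<in> flats"
  | add: "f \<in> flats \<Longrightarrow> g \<in> flats \<Longrightarrow> (\<lambda>x. f x + g x) \<in> flats"
  | mult: "f \<in> flats \<Longrightarrow> g \<in> flats \<Longrightarrow> (\<lambda>x. f x * g x) \<in> flats"

lemma flats_deriv: "f \<in> flats \<Longrightarrow> \<exists>f'\<in>flats. \<forall>x. (f has_real_derivative f' x) (at x)"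
proof (induction rule: flats.induct)
  case (base P c d)
  let ?Q = "smult c (monom 1 2 * (P - pderiv P))"
  have "((\<lambda>x. flat P (c * x + d)) has_real_derivative flat ?Q (c * x + d)) (at x)" for x
    by (rule DERIV_cong[OF DERIV_chain2[OF DERIV_flat]])
      (auto intro!: derivative_eq_intros simp: flat_def)
  then show ?case
    by (intro bexI[of _ "\<lambda>x. flat ?Q (c * x + d)"] flats.base allI)
next
  case (add f g)
  then obtain f' g' where "f' \<in> flats" "g' \<in> flats"
    "\<And>x. (f has_real_derivative f' x) (at x)" "\<And>x. (g has_real_derivative g' x) (at x)" by blast
  then show ?case
    by (intro bexI[of _ "\<lambda>x. f' x + g' x"]) (auto intro: flats.add derivative_intros)
next
  case (mult f g)
  then obtain f' g' where "f' \<in> flats" "g' \<in> flats"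
    "\<And>x. (f has_real_derivative f' x) (at x)" "\<And>x. (g has_real_derivative g' x) (at x)" by blast
  with mult.hyps show ?case
    by (intro bexI[of _ "\<lambda>x. f' x * g x + g' x * f x"])
      (auto intro: flats.add flats.mult DERIV_mult)
qed

lemma flats_smooth: "f \<in> flats \<Longrightarrow> (deriv ^^ n) f differentiable at x"
  using smooth_coinduct[of f flats n] flats_deriv by blast

definition bump :: "real \<Rightarrow> real \<Rightarrow> nat \<Rightarrow> real \<Rightarrow> real"
  where "bump a b n x = flat 1 (real (Suc n) * x + - (real (Suc n) * a)) *
                         flat 1 (- real (Suc n) * x + real (Suc n) * b)"

lemma bump_eq:
  "bump a b n x = (if a < x \<and> x < b
     then exp (- (1 / (real (Suc n) * (x - a)))) * exp (- (1 / (real (Suc n) * (b - x)))) else 0)"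
proof -
  have "0 < real (Suc n) * x + - (real (Suc n) * a) \<longleftrightarrow> a < x"
    by (simp del: of_nat_Suc)
  moreover have "0 < - real (Suc n) * x + real (Suc n) * b \<longleftrightarrow> x < b"
    by (simp del: of_nat_Suc)
  ultimately show ?thesis
    by (simp add: bump_def flat_def right_diff_distrib del: of_nat_Suc)
qed

lemma test_function_bump:
  assumes "0 < a" "b < 1"
  shows "test_function (bump a b n)"
proof -
  have "{x. bump a b n x \<noteq> 0} \<subseteq> {a..b}"
    by (auto simp: bump_eq)
  then have *: "closure {x. bump a b n x \<noteq> 0} \<subseteq> {a..b}"
    by (rule closure_minimal) simp
  then have "bounded (closure {x. bump a b n x \<noteq> 0})"
    using bounded_closed_interval bounded_subset by blast
  moreover have "bump a b n \<in> flats"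
    unfolding bump_def by (intro flats.mult flats.base)
  ultimately show ?thesis
    using * assms by (auto simp: test_function_def compact_eq_bounded_closed flats_smooth)
qed

lemma bump_le_1: "\<bar>bump a b n x\<bar> \<le> 1"
  by (auto simp: bump_eq mult_le_one simp del: of_nat_Suc)

lemma bump_tendsto: "(\<lambda>n. bump a b n x) \<longlonglongrightarrow> indicator {a<..<b} x"
proof (cases "a < x \<and> x < b")
  case True
  have *: "(\<lambda>n. exp (- (1 / (real (Suc n) * c)))) \<longlonglongrightarrow> 1" if "c > 0" for c :: real
  proof -
    have "(\<lambda>n. exp (- (inverse (real (Suc n)) * inverse c))) \<longlonglongrightarrow> exp (- (0 * inverse c))"
      by (intro tendsto_intros LIMSEQ_inverse_real_of_nat)
    then show ?thesis
      by (simp add: divide_inverse)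
  qed
  show ?thesis
    using tendsto_mult[OF *[of "x - a"] *[of "b - x"]] True by (simp add: bump_eq)
qed (auto simp: bump_eq)

lemma continuous_on_test_function:
  assumes "test_function \<phi>"
  shows "continuous_on S \<phi>"
proof -
  have "\<phi> differentiable at x" for x
    using assms by (auto simp: test_function_def dest: spec[of _ 0])
  then show ?thesis
    by (meson continuous_at_imp_continuous_on differentiable_imp_continuous_within)
qed

lemma test_function_imp_0:
  "test_function \<phi> \<Longrightarrow> x \<notin> {0<..<1} \<Longrightarrow> \<phi> x = 0"
  using closure_subset[of "{x. \<phi> x \<noteq> 0}"] by (auto simp: test_function_def)

lemma test_function_deriv:
  assumes "test_function \<phi>"
  shows "test_function (deriv \<phi>)"
proof -
  let ?K = "closure {x. \<phi> x \<noteq> 0}"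
  have "deriv \<phi> x = 0" if "x \<notin> ?K" for x
  proof -
    have "((\<lambda>x. 0) has_real_derivative 0) (at x)" by simp
    then have "(\<phi> has_real_derivative 0) (at x)"
      by (rule has_field_derivative_transform_within_open[where S = "- ?K"])
        (use that closure_subset[of "{x. \<phi> x \<noteq> 0}"] in \<open>auto\<close>)
    then show ?thesis by (rule DERIV_imp_deriv)
  qed
  then have *: "closure {x. deriv \<phi> x \<noteq> 0} \<subseteq> ?K"
    by (intro closure_minimal) auto
  have "(deriv ^^ n) (deriv \<phi>) differentiable at x" for n x
    using assms unfolding test_function_def by (metis comp_apply funpow_Suc_right)
  with * assms show ?thesis
    by (auto simp: test_function_def compact_eq_bounded_closed intro: bounded_subset)
qed

lemma square_integrable_test_function:
  assumes "test_function \<phi>"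
  shows "square_integrable \<phi>"
proof -
  have "compact (\<phi> ` {0..1})"
    by (intro compact_continuous_image continuous_on_test_function assms) auto
  then obtain B where B: "\<And>x. x \<in> {0..1} \<Longrightarrow> \<bar>\<phi> x\<bar> \<le> B"
    by (fastforce dest!: compact_imp_bounded simp: bounded_iff)
  have "\<bar>\<phi> x\<bar> \<le> max B 0" for x
    using B[of x] test_function_imp_0[OF assms, of x] by (cases "x \<in> {0<..<1}") auto
  moreover have "\<phi> \<in> borel_measurable leb01"
    by (intro continuous_imp_measurable_on_sets_lebesgue continuous_on_test_function assms) auto
  ultimately show ?thesis
    by (rule square_integrable_bounded[rotated])
qed

lemma borel_sigma_intervals:
  "sets (borel :: real measure) = sigma_sets UNIV (range (\<lambda>(a::real, b). {a<..<b}))"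
proof -
  have "(borel :: real measure) = sigma UNIV (range (\<lambda>(a, b). {a<..<b}))"
    using borel_eq_box[where 'a = real] by (simp add: box_real)
  then show ?thesis
    by (metis (no_types) Pow_UNIV sets_measure_of top_greatest)
qed

lemma AE_zero_if_interval_integrals_zero:
  fixes h :: "real \<Rightarrow> real"
  assumes h: "integrable lborel h" and total: "integral\<^sup>L lborel h = 0"
    and intervals: "\<And>a b. (LINT x:{a<..<b}|lborel. h x) = 0"
  shows "AE x in lborel. h x = 0"
proof (rule sigma_finite_measure.density_zero[OF lborel.sigma_finite_measure_axioms h])
  fix A :: "real set" assume "A \<in> sets lborel"
  then have "A \<in> sigma_sets UNIV (range (\<lambda>(a::real, b). {a<..<b}))"
    by (simp add: borel_sigma_intervals)
  have Pow_UNIV_subset: "range (\<lambda>(a::real, b). {a<..<b}) \<subseteq> Pow UNIV"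
    by simp
  have stable: "Int_stable (range (\<lambda>(a::real, b). {a<..<b}))"
    by (auto simp: Int_stable_def)
  have meas: "A \<in> sets lborel" if "A \<in> sigma_sets UNIV (range (\<lambda>(a::real, b). {a<..<b}))" for A
    using that by (simp add: borel_sigma_intervals)
  have int: "set_integrable lborel A h" if "A \<in> sets lborel" for A
    using that h unfolding set_integrable_def by (rule integrable_mult_indicator)
  show "(LINT x:A|lborel. h x) = 0"
    using stable Pow_UNIV_subset \<open>A \<in> sigma_sets UNIV _\<close>
  proof (induction rule: sigma_sets_induct_disjoint)
    case (basic A)
    then show ?case using intervals by auto
  next
    case empty
    then show ?case by (simp add: set_lebesgue_integral_def)
  next
    case (compl A)
    have "(LINT x:A \<union> (UNIV - A)|lborel. h x) = (LINT x:A|lborel. h x) + (LINT x:UNIV - A|lborel. h x)"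
      using meas[OF compl(1)] by (intro set_integral_Un int) auto
    with compl total show ?case
      by (simp add: set_lebesgue_integral_def)
  next
    case (union A)
    have "(LINT x:(\<Union>i. A i)|lborel. h x) = (\<Sum>i. (LINT x:(A i)|lborel. h x))"
    proof (rule lebesgue_integral_countable_add)
      show *: "A i \<in> sets lborel" for i
        using union(2) by (intro meas) auto
      then show "set_integrable lborel (\<Union>i. A i) h"
        by (intro int sets.countable_UN) auto
    qed (use union(1) in \<open>auto simp: disjoint_family_on_def\<close>)
    with union show ?case by simp
  qed
qed

lemma fundamental_lemma:
  assumes f: "integrable leb01 f"
    and test: "\<And>\<phi>. test_function \<phi> \<Longrightarrow> (LINT x|leb01. f x * \<phi> x) = 0"
  shows "AE x in leb01. f x = 0"
proof -
  note [measurable] = borel_measurable_integrable[OF f]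
  have ind: "indicator {a<..<b} \<in> borel_measurable leb01" for a b :: real
    by (intro measurable_restrict_space1 borel_measurable_indicator) simp
  note [measurable] = ind
  have bump_meas [measurable]: "bump a b n \<in> borel_measurable leb01" if "0 < a" "b < 1" for a b n
    using square_integrable_test_function[OF test_function_bump[OF that]]
    by (simp add: square_integrable_def)
  have inner: "(LINT x|leb01. f x * indicator {a<..<b} x) = 0" if ab: "0 < a" "b < 1" for a b
  proof -
    note [measurable] = bump_meas[OF ab]
    have "(\<lambda>n. LINT x|leb01. f x * bump a b n x) \<longlonglongrightarrow> (LINT x|leb01. f x * indicator {a<..<b} x)"
    proof (rule integral_dominated_convergence[where w = "\<lambda>x. \<bar>f x\<bar>"])
      show "AE x in leb01. (\<lambda>n. f x * bump a b n x) \<longlonglongrightarrow> f x * indicator {a<..<b} x"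
        by (intro AE_I2 tendsto_intros bump_tendsto)
      show "AE x in leb01. norm (f x * bump a b n x) \<le> \<bar>f x\<bar>" for n
        using bump_le_1 by (intro AE_I2) (auto simp: abs_mult intro: mult_left_le)
    qed (use f in auto)
    then show ?thesis
      using test[OF test_function_bump[OF ab]] by (simp add: LIMSEQ_const_iff)
  qed
  have outer: "(LINT x|leb01. f x * indicator {a<..<b} x) = 0" for a b :: real
  proof -
    define J where "J n = {max a (inverse (real (Suc n)))<..<min b (1 - inverse (real (Suc n)))}" for n
    have [measurable]: "indicator (J n) \<in> borel_measurable leb01" for n
      unfolding J_def by (rule ind)
    have "(\<lambda>n. LINT x|leb01. f x * indicator (J n) x) \<longlonglongrightarrow> (LINT x|leb01. f x * indicator {a<..<b} x)"
    proof (rule integral_dominated_convergence[where w = "\<lambda>x. \<bar>f x\<bar>"])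
      have "(\<lambda>n. indicator (J n) x) \<longlonglongrightarrow> (indicator {a<..<b} x :: real)" if x: "x \<in> {0<..<1}" for x
      proof (rule tendsto_eventually)
        have "eventually (\<lambda>n. inverse (real (Suc n)) < min x (1 - x)) sequentially"
          by (rule order_tendstoD[OF LIMSEQ_inverse_real_of_nat]) (use x in auto)
        then show "eventually (\<lambda>n. indicator (J n) x = (indicator {a<..<b} x :: real)) sequentially"
          by eventually_elim (auto simp: J_def indicator_def)
      qed
      then show "AE x in leb01. (\<lambda>n. f x * indicator (J n) x) \<longlonglongrightarrow> f x * indicator {a<..<b} x"
        by (intro AE_I2 tendsto_intros) auto
      show "AE x in leb01. norm (f x * indicator (J n) x) \<le> \<bar>f x\<bar>" for n
        by (auto simp: indicator_def)
    qed (use f in auto)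
    moreover have "(LINT x|leb01. f x * indicator (J n) x) = 0" for n
      unfolding J_def by (rule inner) (auto simp: less_max_iff_disj min_less_iff_disj simp del: of_nat_Suc)
    ultimately show ?thesis
      by (simp add: LIMSEQ_const_iff)
  qed
  define g where "g x = indicator {0<..<1} x * f x" for x
  have g: "integrable lebesgue g"
    using f by (simp add: g_def[abs_def] integrable_restrict_space)
  obtain h where h [measurable]: "h \<in> borel_measurable lborel" and gh: "AE x in lborel. g x = h x"
    using completion_ex_borel_measurable_real[OF borel_measurable_integrable[OF g]] by auto
  have gh': "AE x in lebesgue. g x = h x"
    using gh by (rule AE_completion)
  have h_leb [measurable]: "h \<in> borel_measurable lebesgue"
    using h by (rule measurable_completion)
  note [measurable] = borel_measurable_integrable[OF g]
  have "integrable lebesgue h"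
    by (rule integrable_cong_AE_imp[OF g h_leb]) (use gh' in eventually_elim, simp)
  then have inth: "integrable lborel h"
    using integrable_completion[OF h] by simp
  have *: "(LINT x:A|lborel. h x) = (LINT x|leb01. f x * indicator A x)"
    if A: "A \<in> sets borel" for A
  proof -
    have indA: "indicat_real A \<in> borel_measurable lborel"
      using A by simp
    note [measurable] = measurable_completion[OF indA]
    have "(LINT x:A|lborel. h x) = (LINT x|lebesgue. indicator A x * h x)"
      unfolding set_lebesgue_integral_def real_scaleR_def
      by (rule integral_completion[symmetric]) (intro borel_measurable_times indA h)
    also have "\<dots> = (LINT x|lebesgue. indicator A x * g x)"
    proof (rule integral_cong_AE)
      show "AE x in lebesgue. indicat_real A x * h x = indicat_real A x * g x"
        using gh' by eventually_elim simp
    qed measurable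
    also have "\<dots> = (LINT x|leb01. f x * indicator A x)"
      by (simp add: integral_restrict_space g_def ac_simps)
    finally show ?thesis .
  qed
  have "AE x in lborel. h x = 0"
  proof (rule AE_zero_if_interval_integrals_zero[OF inth])
    show "(LINT x:{a<..<b}|lborel. h x) = 0" for a b
      using *[of "{a<..<b}"] outer[of a b] by simp
    have "integral\<^sup>L lborel h = (LINT x|leb01. f x * indicator UNIV x)"
      using *[of UNIV] by (simp add: set_lebesgue_integral_def)
    also have "\<dots> = (LINT x|leb01. f x * indicator {0<..<1} x)"
      by (rule Bochner_Integration.integral_cong) auto
    finally show "integral\<^sup>L lborel h = 0"
      using outer[of 0 1] by simp
  qed
  with gh have "AE x in lborel. g x = 0"
    by eventually_elim simp
  then have "AE x in lebesgue. g x = 0"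
    by (rule AE_completion)
  then show ?thesis
    by (subst AE_restrict_space_iff) (auto simp: g_def)
qed

lift_definition has_weak_deriv :: "l2 \<Rightarrow> l2 \<Rightarrow> bool"
  is "\<lambda>p g. \<forall>\<phi>. test_function \<phi> \<longrightarrow>
        (LINT x|leb01. p x * deriv \<phi> x) = - (LINT x|leb01. g x * \<phi> x)"
proof -
  fix p p' g g' :: "real \<Rightarrow> real"
  assume pg: "l2_rel p p'" "l2_rel g g'"
  have "(LINT x|leb01. p x * \<psi> x) = (LINT x|leb01. p' x * \<psi> x)"
    if "l2_rel p p'" "test_function \<psi>" for p p' \<psi>
  proof -
    note [measurable] = l2_rel_measurable[OF that(1)]
    have [measurable]: "\<psi> \<in> borel_measurable leb01"
      using square_integrable_test_function[OF that(2)] by (simp add: square_integrable_def)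
    show ?thesis
      by (rule integral_cong_AE) (use that(1) in \<open>auto simp: l2_rel_def\<close>)
  qed
  note * = this
  have "(LINT x|leb01. p x * deriv \<phi> x) = (LINT x|leb01. p' x * deriv \<phi> x)"
    "(LINT x|leb01. g x * \<phi> x) = (LINT x|leb01. g' x * \<phi> x)" if "test_function \<phi>" for \<phi>
    by (rule *[OF pg(1) test_function_deriv[OF that]], rule *[OF pg(2) that])
  then show "(\<forall>\<phi>. test_function \<phi> \<longrightarrow> (LINT x|leb01. p x * deriv \<phi> x) = - (LINT x|leb01. g x * \<phi> x)) \<longleftrightarrow>
        (\<forall>\<phi>. test_function \<phi> \<longrightarrow> (LINT x|leb01. p' x * deriv \<phi> x) = - (LINT x|leb01. g' x * \<phi> x))"
    by simp
qed

lemma has_weak_deriv_add: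
  assumes "has_weak_deriv p g" "has_weak_deriv q h"
  shows "has_weak_deriv (p + q) (g + h)"
  using assms
  by transfer
    (auto simp: l2_rel_def distrib_right square_integrable_mult square_integrable_test_function test_function_deriv)

lemma has_weak_deriv_scaleR:
  assumes "has_weak_deriv p g"
  shows "has_weak_deriv (c *\<^sub>R p) (c *\<^sub>R g)"
  using assms by transfer (simp add: mult.assoc)

lemma has_weak_deriv_0: "has_weak_deriv 0 0"
  by transfer simp

lemma has_weak_deriv_0_imp_0: "has_weak_deriv 0 g \<Longrightarrow> g = 0"
proof transfer
  fix f :: "real \<Rightarrow> real"
  assume f: "l2_rel f f"
    and *: "\<forall>\<phi>. test_function \<phi> \<longrightarrow> (LINT x|leb01. 0 * deriv \<phi> x) = - (LINT x|leb01. f x * \<phi> x)"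
  have "AE x in leb01. f x = 0"
  proof (rule fundamental_lemma)
    show "integrable leb01 f"
      using f by (simp add: l2_rel_def square_integrable_imp_integrable)
    show "(LINT x|leb01. f x * \<phi> x) = 0" if "test_function \<phi>" for \<phi>
      using * that by simp
  qed
  with f show "l2_rel f (\<lambda>x. 0)"
    by (simp add: l2_rel_def square_integrable_0)
qed

lemma has_weak_deriv_unique:
  assumes "has_weak_deriv p g" "has_weak_deriv p h"
  shows "g = h"
proof -
  have "has_weak_deriv 0 (g - h)"
    using has_weak_deriv_add[OF assms(1) has_weak_deriv_scaleR[OF assms(2), of "-1"]] by simp
  then have "g - h = 0"
    by (rule has_weak_deriv_0_imp_0)
  then show ?thesis by simp
qed

definition weak_deriv :: "l2 \<Rightarrow> l2"
  where "weak_deriv p = (THE g. has_weak_deriv p g)"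

lemma weak_deriv_eqI: "has_weak_deriv p g \<Longrightarrow> weak_deriv p = g"
  unfolding weak_deriv_def by (rule the_equality) (auto intro: has_weak_deriv_unique)

definition H2 :: "l2 set"
  where "H2 = {p. \<exists>g h. has_weak_deriv p g \<and> has_weak_deriv g h}"

lemma H2_weak_deriv:
  assumes "p \<in> H2"
  shows "has_weak_deriv p (weak_deriv p)"
    and "has_weak_deriv (weak_deriv p) (weak_deriv (weak_deriv p))"
proof -
  obtain g h where "has_weak_deriv p g" "has_weak_deriv g h"
    using assms by (auto simp: H2_def)
  moreover from this have "weak_deriv p = g" "weak_deriv g = h"
    by (auto intro: weak_deriv_eqI)
  ultimately show "has_weak_deriv p (weak_deriv p)"
    "has_weak_deriv (weak_deriv p) (weak_deriv (weak_deriv p))"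
    by simp_all
qed

lemma H2_add:
  assumes "p \<in> H2" "q \<in> H2"
  shows "p + q \<in> H2"
    and "weak_deriv (p + q) = weak_deriv p + weak_deriv q"
    and "weak_deriv (weak_deriv (p + q)) = weak_deriv (weak_deriv p) + weak_deriv (weak_deriv q)"
proof -
  note d = has_weak_deriv_add[OF H2_weak_deriv(1)[OF assms(1)] H2_weak_deriv(1)[OF assms(2)]]
    has_weak_deriv_add[OF H2_weak_deriv(2)[OF assms(1)] H2_weak_deriv(2)[OF assms(2)]]
  show "p + q \<in> H2"
    using d by (auto simp: H2_def)
  show *: "weak_deriv (p + q) = weak_deriv p + weak_deriv q"
    using d(1) by (rule weak_deriv_eqI)
  show "weak_deriv (weak_deriv (p + q)) = weak_deriv (weak_deriv p) + weak_deriv (weak_deriv q)"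
    unfolding * using d(2) by (rule weak_deriv_eqI)
qed

lemma H2_scaleR:
  assumes "p \<in> H2"
  shows "c *\<^sub>R p \<in> H2"
    and "weak_deriv (c *\<^sub>R p) = c *\<^sub>R weak_deriv p"
    and "weak_deriv (weak_deriv (c *\<^sub>R p)) = c *\<^sub>R weak_deriv (weak_deriv p)"
proof -
  note d = has_weak_deriv_scaleR[OF H2_weak_deriv(1)[OF assms], of c]
    has_weak_deriv_scaleR[OF H2_weak_deriv(2)[OF assms], of c]
  show "c *\<^sub>R p \<in> H2"
    using d by (auto simp: H2_def)
  show *: "weak_deriv (c *\<^sub>R p) = c *\<^sub>R weak_deriv p"
    using d(1) by (rule weak_deriv_eqI)
  show "weak_deriv (weak_deriv (c *\<^sub>R p)) = c *\<^sub>R weak_deriv (weak_deriv p)"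
    unfolding * using d(2) by (rule weak_deriv_eqI)
qed

text \<open>Elements of \<^typ>\<open>l2\<close> have no point values; \<open>p(x)\<close> means the value at \<open>x\<close> of the
  representative that is continuous on \<open>[0,1]\<close>. It is unique if it exists, and by the Sobolev
  embedding it exists for \<open>p\<close> and its weak derivative when \<open>p \<in> H2\<close>.\<close>

lift_definition continuous_rep :: "l2 \<Rightarrow> (real \<Rightarrow> real) \<Rightarrow> bool"
  is "\<lambda>p u. continuous_on {0..1} u \<and> (AE x in leb01. p x = u x)"
proof -
  fix p q :: "real \<Rightarrow> real"
  assume "l2_rel p q"
  then have "AE x in leb01. p x = q x" by (simp add: l2_rel_def)
  note pq = this
  have "(AE x in leb01. p x = u x) \<longleftrightarrow> (AE x in leb01. q x = u x)" for u
  proof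
    assume "AE x in leb01. p x = u x"
    with pq show "AE x in leb01. q x = u x" by eventually_elim simp
  next
    assume "AE x in leb01. q x = u x"
    with pq show "AE x in leb01. p x = u x" by eventually_elim simp
  qed
  then show "(\<lambda>u. continuous_on {0..1} u \<and> (AE x in leb01. p x = u x)) =
      (\<lambda>u. continuous_on {0..1} u \<and> (AE x in leb01. q x = u x))"
    by simp
qed

definition has_value_at :: "l2 \<Rightarrow> real \<Rightarrow> real \<Rightarrow> bool"
  where "has_value_at p x y \<longleftrightarrow> (\<exists>u. continuous_rep p u \<and> u x = y)"

lemma has_value_at_add:
  assumes "has_value_at p x a" "has_value_at q x b"
  shows "has_value_at (p + q) x (a + b)"
proof -
  obtain u v where uv: "continuous_rep p u" "u x = a" "continuous_rep q v" "v x = b"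
    using assms by (auto simp: has_value_at_def)
  have "continuous_rep (p + q) (\<lambda>x. u x + v x)"
    using uv(1,3) by transfer (auto intro: continuous_on_add elim: eventually_elim2)
  then show ?thesis
    using uv by (auto simp: has_value_at_def)
qed

lemma has_value_at_scaleR:
  assumes "has_value_at p x a"
  shows "has_value_at (c *\<^sub>R p) x (c * a)"
proof -
  obtain u where u: "continuous_rep p u" "u x = a"
    using assms by (auto simp: has_value_at_def)
  have "continuous_rep (c *\<^sub>R p) (\<lambda>x. c * u x)"
    using u(1) by transfer (auto intro: continuous_on_mult_left)
  then show ?thesis
    using u by (auto simp: has_value_at_def)
qed

lemma has_value_at_0: "has_value_at 0 x 0"
proof -
  have "continuous_rep 0 (\<lambda>x. 0)"
    by transfer auto
  then show ?thesis
    by (auto simp: has_value_at_def)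
qed

lemma V_zero: "0 \<in> {p \<in> H2. has_value_at p 0 0 \<and> has_value_at (weak_deriv p) 1 0}"
  using has_weak_deriv_0 by (auto simp: H2_def weak_deriv_eqI[OF has_weak_deriv_0] has_value_at_0)

lemma V_add:
  assumes "p \<in> {p \<in> H2. has_value_at p 0 0 \<and> has_value_at (weak_deriv p) 1 0}" "q \<in> {p \<in> H2. has_value_at p 0 0 \<and> has_value_at (weak_deriv p) 1 0}"
  shows "p + q \<in> {p \<in> H2. has_value_at p 0 0 \<and> has_value_at (weak_deriv p) 1 0}"
proof -
  have "p \<in> H2" "q \<in> H2"
    using assms by simp_all
  note this H2_add[OF this]
  moreover have "has_value_at (p + q) 0 (0 + 0)" "has_value_at (weak_deriv p + weak_deriv q) 1 (0 + 0)"
    using assms by (intro has_value_at_add; simp)+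
  ultimately show ?thesis by simp
qed

lemma V_scaleR:
  assumes "p \<in> {p \<in> H2. has_value_at p 0 0 \<and> has_value_at (weak_deriv p) 1 0}"
  shows "c *\<^sub>R p \<in> {p \<in> H2. has_value_at p 0 0 \<and> has_value_at (weak_deriv p) 1 0}"
proof -
  have "p \<in> H2"
    using assms by simp
  note this H2_scaleR[OF this]
  moreover have "has_value_at (c *\<^sub>R p) 0 (c * 0)" "has_value_at (c *\<^sub>R weak_deriv p) 1 (c * 0)"
    using assms by (intro has_value_at_scaleR; simp)+
  ultimately show ?thesis by simp
qed

typedef V = "{p \<in> H2. has_value_at p 0 0 \<and> has_value_at (weak_deriv p) 1 0}"
  using V_zero by blast

lemma Rep_V_H2: "Rep_V p \<in> H2"
  using Rep_V[of p] by simp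

definition D1 :: "V \<Rightarrow> l2" where "D1 p = weak_deriv (Rep_V p)"
definition D2 :: "V \<Rightarrow> l2" where "D2 p = weak_deriv (weak_deriv (Rep_V p))"

instantiation V :: real_inner
begin

definition zero_V :: V where "0 = Abs_V 0"
definition plus_V :: "V \<Rightarrow> V \<Rightarrow> V" where "p + q = Abs_V (Rep_V p + Rep_V q)" for p q :: V
definition scaleR_V :: "real \<Rightarrow> V \<Rightarrow> V" where "c *\<^sub>R p = Abs_V (c *\<^sub>R Rep_V p)" for p :: V
definition inner_V :: "V \<Rightarrow> V \<Rightarrow> real"
  where "inner p q = inner (Rep_V p) (Rep_V q) + inner (D1 p) (D1 q) + inner (D2 p) (D2 q)" for p q :: V

definition uminus_V :: "V \<Rightarrow> V" where "- p = (-1) *\<^sub>R p" for p :: V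
definition minus_V :: "V \<Rightarrow> V \<Rightarrow> V" where "p - q = p + - q" for p q :: V
definition norm_V :: "V \<Rightarrow> real" where "norm p = sqrt (inner p p)" for p :: V
definition sgn_V :: "V \<Rightarrow> V" where "sgn p = inverse (norm p) *\<^sub>R p" for p :: V
definition dist_V :: "V \<Rightarrow> V \<Rightarrow> real" where "dist p q = norm (p - q)" for p q :: V
definition uniformity_V :: "(V \<times> V) filter"
  where "uniformity = (INF e\<in>{0<..}. principal {(x::V, y). dist x y < e})"
definition open_V :: "V set \<Rightarrow> bool"
  where "open U = (\<forall>x\<in>U. eventually (\<lambda>(x', y). x' = x \<longrightarrow> y \<in> U) uniformity)" for U :: "V set"

lemma Rep_V_zero: "Rep_V 0 = 0"
  unfolding zero_V_def by (rule Abs_V_inverse[OF V_zero])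

lemma Rep_V_add: "Rep_V (p + q) = Rep_V p + Rep_V q"
  unfolding plus_V_def by (rule Abs_V_inverse[OF V_add[OF Rep_V Rep_V]])

lemma Rep_V_scaleR: "Rep_V (c *\<^sub>R p) = c *\<^sub>R Rep_V p"
  unfolding scaleR_V_def by (rule Abs_V_inverse[OF V_scaleR[OF Rep_V]])

lemma D1_add: "D1 (p + q) = D1 p + D1 q"
  and D2_add: "D2 (p + q) = D2 p + D2 q"
  and D1_scaleR: "D1 (c *\<^sub>R p) = c *\<^sub>R D1 p"
  and D2_scaleR: "D2 (c *\<^sub>R p) = c *\<^sub>R D2 p"
  using H2_add(2,3)[OF Rep_V_H2 Rep_V_H2] H2_scaleR(2,3)[OF Rep_V_H2]
  by (simp_all add: D1_def D2_def Rep_V_add Rep_V_scaleR)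

instance
proof
  fix p q r :: V and a b :: real and U :: "V set"
  show "p + q + r = p + (q + r)"
    by (simp add: Rep_V_inject[symmetric] Rep_V_zero Rep_V_add Rep_V_scaleR add.assoc)
  show "p + q = q + p"
    by (simp add: Rep_V_inject[symmetric] Rep_V_zero Rep_V_add Rep_V_scaleR add.commute)
  show "0 + p = p"
    by (simp add: Rep_V_inject[symmetric] Rep_V_zero Rep_V_add Rep_V_scaleR)
  show "- p + p = 0"
    by (simp add: uminus_V_def Rep_V_inject[symmetric] Rep_V_zero Rep_V_add Rep_V_scaleR)
  show "p - q = p + - q"
    by (simp add: minus_V_def)
  show "a *\<^sub>R (p + q) = a *\<^sub>R p + a *\<^sub>R q"
    by (simp add: Rep_V_inject[symmetric] Rep_V_zero Rep_V_add Rep_V_scaleR scaleR_add_right)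
  show "(a + b) *\<^sub>R p = a *\<^sub>R p + b *\<^sub>R p"
    by (simp add: Rep_V_inject[symmetric] Rep_V_zero Rep_V_add Rep_V_scaleR scaleR_add_left)
  show "a *\<^sub>R b *\<^sub>R p = (a * b) *\<^sub>R p"
    by (simp add: Rep_V_inject[symmetric] Rep_V_zero Rep_V_add Rep_V_scaleR)
  show "1 *\<^sub>R p = p"
    by (simp add: Rep_V_inject[symmetric] Rep_V_zero Rep_V_add Rep_V_scaleR)
  show "sgn p = inverse (norm p) *\<^sub>R p"
    by (simp add: sgn_V_def)
  show "dist p q = norm (p - q)"
    by (simp add: dist_V_def)
  show "uniformity = (INF e\<in>{0<..}. principal {(x::V, y). dist x y < e})"
    by (simp add: uniformity_V_def)
  show "open U = (\<forall>x\<in>U. eventually (\<lambda>(x', y). x' = x \<longrightarrow> y \<in> U) uniformity)"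
    by (simp add: open_V_def)
  show "inner p q = inner q p"
    by (simp add: inner_V_def inner_commute)
  show "inner (p + q) r = inner p r + inner q r"
    by (simp add: inner_V_def Rep_V_add D1_add D2_add inner_add_left)
  show "inner (a *\<^sub>R p) q = a * inner p q"
    by (simp add: inner_V_def Rep_V_scaleR D1_scaleR D2_scaleR distrib_left)
  show "0 \<le> inner p p"
    by (simp add: inner_V_def)
  show "inner p p = 0 \<longleftrightarrow> p = 0"
  proof
    assume "inner p p = 0"
    moreover have "inner (Rep_V p) (Rep_V p) \<le> inner p p"
      by (simp add: inner_V_def)
    ultimately have "inner (Rep_V p) (Rep_V p) = 0"
      using inner_ge_zero[of "Rep_V p"] by linarith
    then show "p = 0"
      by (simp add: Rep_V_inject[symmetric] Rep_V_zero)
  next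
    assume "p = 0"
    then show "inner p p = 0"
      by (simp add: inner_V_def D1_def D2_def Rep_V_zero weak_deriv_eqI[OF has_weak_deriv_0])
  qed
  show "norm p = sqrt (inner p p)"
    by (simp add: norm_V_def)
qed

end

lemma norm_D2_le: "norm (D2 p) \<le> norm p"
  unfolding norm_eq_sqrt_inner by (simp add: inner_V_def)

lemma bounded_linear_D2: "bounded_linear D2"
  by (rule bounded_linear_intro[where K = 1]) (auto simp: D2_add D2_scaleR norm_D2_le)

text \<open>The dual space $H^{-2}(0,1) = V^*$ is \<^typ>\<open>V \<Rightarrow>\<^sub>L real\<close>, and the duality pairing is
  \<^const>\<open>blinfun_apply\<close>. The next lemma shows that the three variational identities define
  operators; they obviously determine them.\<close>

lemma ex_operators:
  "\<exists>A11 :: V \<Rightarrow> (V \<Rightarrow>\<^sub>L real). \<forall>p1 p2. blinfun_apply (A11 p1) p2 = inner (D2 p1) (D2 p2)"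
  "\<exists>A12 :: l2 \<Rightarrow> (V \<Rightarrow>\<^sub>L real). \<forall>q p1. blinfun_apply (A12 q) p1 = inner q (D2 p1)"
  "\<exists>A21 :: V \<Rightarrow> l2. \<forall>p1 q. inner (A21 p1) q = - inner (D2 p1) q"
proof -
  have "bounded_linear (\<lambda>p. inner q (D2 p))" for q
    using bounded_linear_inner_right bounded_linear_D2 by (rule bounded_linear_compose)
  then have *: "blinfun_apply (Blinfun (\<lambda>p. inner q (D2 p))) p = inner q (D2 p)" for q p
    by (simp add: bounded_linear_Blinfun_apply)
  show "\<exists>A11 :: V \<Rightarrow> (V \<Rightarrow>\<^sub>L real). \<forall>p1 p2. blinfun_apply (A11 p1) p2 = inner (D2 p1) (D2 p2)"
    by (rule exI[of _ "\<lambda>p1. Blinfun (\<lambda>p. inner (D2 p1) (D2 p))"]) (simp add: *)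
  show "\<exists>A12 :: l2 \<Rightarrow> (V \<Rightarrow>\<^sub>L real). \<forall>q p1. blinfun_apply (A12 q) p1 = inner q (D2 p1)"
    by (rule exI[of _ "\<lambda>q. Blinfun (\<lambda>p. inner q (D2 p))"]) (simp add: *)
  show "\<exists>A21 :: V \<Rightarrow> l2. \<forall>p1 q. inner (A21 p1) q = - inner (D2 p1) q"
    by (rule exI[of _ "\<lambda>p. - D2 p"]) simp
qed

definition accretive_on :: "'a::real_inner set \<Rightarrow> ('a \<Rightarrow> 'a) \<Rightarrow> bool"
  where "accretive_on D T \<longleftrightarrow> (\<forall>x\<in>D. 0 \<le> inner (T x) x)"

end

theory Submission
  imports Defs
begin

text \<open>Integrating \<open>q\<close> twice, first from \<open>1\<close> and then from \<open>0\<close>, gives \<open>p \<in> V\<close> with \<open>p'' = q\<close>, so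
  \<open>D2\<close> maps \<open>V\<close> onto \<open>L\<^sup>2(0,1)\<close>. The equation \<open>A11 p = A12 q\<close> says that \<open>p'' - q\<close> is
  orthogonal to the range of \<open>D2\<close>. Hence it is solvable, and each of its solutions satisfies
  \<open>p'' = q\<close>. Since \<open>A21 p = - p''\<close>, the Schur complement is the identity.\<close>

lemma finite_measure_leb01: "finite_measure leb01"
  by (auto intro!: finite_measureI simp: emeasure_restrict_space)

text \<open>Makes the triangle \<open>t < x\<close> measurable for the product of
  \<open>leb01\<close> with itself, where the kernel of the Fubini argument lives.\<close>

lemma borel_measurable_ident_leb01: "(\<lambda>x. x) \<in> borel_measurable leb01"
  by (intro continuous_imp_measurable_on_sets_lebesgue continuous_on_id) auto

lemma test_function_has_real_derivative:
  assumes "test_function \<phi>"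
  shows "(\<phi> has_real_derivative deriv \<phi> x) (at x)"
proof -
  have "\<phi> differentiable at x"
    using assms by (auto simp: test_function_def dest: spec[of _ 0])
  then show ?thesis
    by (simp add: DERIV_deriv_iff_real_differentiable)
qed

text \<open>Continuity up to the endpoints makes both \<open>u\<close> and its square absolutely
  integrable. This places indefinite integrals in \<open>l2\<close>.\<close>

lemma square_integrable_continuous_on:
  assumes "continuous_on {0..1} u"
  shows "square_integrable u"
proof -
  have *: "integrable leb01 v" if "continuous_on {0..1} v" for v :: "real \<Rightarrow> real"
  proof -
    have "set_integrable lebesgue {0..1} v"
      using that by (rule absolutely_integrable_continuous_real)
    then have "set_integrable lebesgue {0<..<1} v"
      by (rule set_integrable_subset) auto
    then show ?thesis
      by (simp add: set_integrable_def integrable_restrict_space)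
  qed
  have "continuous_on {0..1} (\<lambda>x. (u x)\<^sup>2)"
    using assms by (intro continuous_intros)
  with *[OF assms] *[OF this] show ?thesis
    by (auto simp: square_integrable_def)
qed

text \<open>Passes from the Bochner integral to the gauge integral, for which continuity of
  indefinite integrals is available.\<close>

lemma integrable_leb01_imp_integrable_on:
  fixes f :: "real \<Rightarrow> real"
  assumes "integrable leb01 f"
  shows "f integrable_on {0..1}"
proof -
  have "set_integrable lebesgue {0<..<1} f"
    using assms by (simp add: set_integrable_def integrable_restrict_space)
  then have "f integrable_on {0<..<1}"
    by (rule set_lebesgue_integral_eq_integral(1))
  then show ?thesis
    by (simp add: integrable_on_Icc_iff_Ioo)
qed

lemma integrable_leb01_indicator_mult:
  fixes f :: "real \<Rightarrow> real"
  assumes f: "integrable leb01 f" and A: "A \<in> sets borel"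
  shows "integrable leb01 (\<lambda>t. indicator A t * f t)"
proof (rule Bochner_Integration.integrable_bound[OF f])
  have "indicat_real A \<in> borel_measurable leb01"
    using A by (intro measurable_restrict_space1 borel_measurable_indicator) auto
  then show "(\<lambda>t. indicator A t * f t) \<in> borel_measurable leb01"
    using f by auto
qed (auto simp: indicator_def)

text \<open>Lets Fubini run over the fixed measure \<open>leb01\<close> while the variable limits
  sit in an indicator.\<close>

lemma integral_leb01_indicator_Ioo:
  fixes f :: "real \<Rightarrow> real"
  assumes f: "integrable leb01 f" and ab: "0 \<le> a" "b \<le> 1"
  shows "(LINT t|leb01. indicator {a<..<b} t * f t) = integral {a..b} f"
proof -
  have "(LINT t|leb01. indicator {a<..<b} t * f t) =
      integral {0<..<1} (\<lambda>t. indicator {a<..<b} t * f t)"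
    by (rule lebesgue_integral_eq_integral)
      (auto intro: integrable_leb01_indicator_mult[OF f])
  also have "\<dots> = integral {0<..<1} (\<lambda>t. if t \<in> {a<..<b} then f t else 0)"
    by (rule arg_cong[where f = "integral _"]) (auto simp: indicator_def)
  also have "\<dots> = integral ({0<..<1} \<inter> {a<..<b}) f"
    by (simp add: Henstock_Kurzweil_Integration.integral_restrict_Int Int_commute
        del: greaterThanLessThan_iff Int_greaterThanLessThan)
  also have "{0<..<1} \<inter> {a<..<b} = {a<..<b}"
    using ab by auto
  finally show ?thesis
    by (simp add: integral_open_interval_real)
qed

text \<open>The fundamental theorem of calculus on \<open>{t..1}\<close>; the boundary term at 1
  vanishes because the support of \<open>\<phi>\<close> lies inside the open interval.\<close>

lemma integral_deriv_test_function:
  assumes \<phi>: "test_function \<phi>" and t: "0 \<le> t" "t \<le> 1"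
  shows "(LINT x|leb01. indicator {t<..<1} x * deriv \<phi> x) = - \<phi> t"
proof -
  have "(deriv \<phi> has_integral (\<phi> 1 - \<phi> t)) {t..1}"
  proof (rule fundamental_theorem_of_calculus[OF t(2)])
    show "(\<phi> has_vector_derivative deriv \<phi> x) (at x within {t..1})" for x
      using test_function_has_real_derivative[OF \<phi>]
      by (auto simp: has_real_derivative_iff_has_vector_derivative
          intro: has_vector_derivative_at_within)
  qed
  then show ?thesis
    using test_function_imp_0[OF \<phi>, of 1] t
    by (subst integral_leb01_indicator_Ioo)
      (auto simp: integral_unique
        intro: square_integrable_imp_integrable square_integrable_test_function
          test_function_deriv \<phi>)
qed

text \<open>Fubini for \<open>f(t) \<phi>'(x)\<close> on the triangle \<open>t < x\<close>.\<close>

lemma integral_by_parts_test_function: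
  assumes f: "integrable leb01 f" and \<phi>: "test_function \<phi>"
    and F: "\<And>x. x \<in> {0<..<1} \<Longrightarrow> F x = c + integral {0..x} f"
  shows "(LINT x|leb01. F x * deriv \<phi> x) = - (LINT x|leb01. f x * \<phi> x)"
proof -
  interpret M: finite_measure leb01 by (rule finite_measure_leb01)
  interpret P: pair_sigma_finite leb01 leb01 ..
  note [measurable] = borel_measurable_ident_leb01
  define k where "k t x = (if t < x then f t * deriv \<phi> x else 0)" for t x
  have d: "integrable leb01 (deriv \<phi>)"
    by (intro square_integrable_imp_integrable square_integrable_test_function
        test_function_deriv \<phi>)
  note [measurable] = borel_measurable_integrable[OF f] borel_measurable_integrable[OF d]
  have ind: "indicator {0<..<x} t = (if t < x then 1 else (0::real))"
    "indicator {t<..<1} x = (if t < x then 1 else (0::real))"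
    if "x \<in> {0<..<1}" "t \<in> {0<..<1}" for t x :: real
    using that by (auto simp: indicator_def)
  \<comment> \<open>The full product of two integrable factors is integrable on the square and
    dominates its restriction \<open>k\<close> to the triangle.\<close>
  have "integrable (leb01 \<Otimes>\<^sub>M leb01) (\<lambda>(t, x). f t * deriv \<phi> x)"
    by (rule P.Fubini_integrable) (use f d in \<open>auto simp: abs_mult\<close>)
  then have "integrable (leb01 \<Otimes>\<^sub>M leb01) (\<lambda>(t, x). k t x)"
    by (rule Bochner_Integration.integrable_bound) (auto simp: k_def)
  then have swap: "(LINT x|leb01. LINT t|leb01. k t x) = (LINT t|leb01. LINT x|leb01. k t x)"
    by (rule P.Fubini_integral)
  have inner_t: "(LINT t|leb01. k t x) = (F x - c) * deriv \<phi> x" if "x \<in> {0<..<1}" for x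
  proof -
    have "(LINT t|leb01. k t x) = (LINT t|leb01. indicator {0<..<x} t * f t * deriv \<phi> x)"
      by (rule Bochner_Integration.integral_cong) (use that in \<open>auto simp: k_def ind\<close>)
    also have "\<dots> = integral {0..x} f * deriv \<phi> x"
      using that by (simp add: integral_leb01_indicator_Ioo[OF f])
    finally show ?thesis
      using F[OF that] by simp
  qed
  have inner_x: "(LINT x|leb01. k t x) = - (f t * \<phi> t)" if "t \<in> {0<..<1}" for t
  proof -
    have "(LINT x|leb01. k t x) = (LINT x|leb01. f t * (indicator {t<..<1} x * deriv \<phi> x))"
      by (rule Bochner_Integration.integral_cong) (use that in \<open>auto simp: k_def ind\<close>)
    also have "\<dots> = - (f t * \<phi> t)"
      using that by (simp add: integral_deriv_test_function[OF \<phi>])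
    finally show ?thesis .
  qed
  have "(LINT x|leb01. LINT t|leb01. k t x) = (LINT x|leb01. (F x - c) * deriv \<phi> x)"
    by (rule Bochner_Integration.integral_cong) (auto simp: inner_t)
  moreover have "(LINT t|leb01. LINT x|leb01. k t x) = (LINT t|leb01. - (f t * \<phi> t))"
    by (rule Bochner_Integration.integral_cong) (auto simp: inner_x)
  ultimately have 1: "(LINT x|leb01. (F x - c) * deriv \<phi> x) = - (LINT x|leb01. f x * \<phi> x)"
    using swap by simp
  \<comment> \<open>Since \<open>\<phi>\<close> also vanishes at 0, its derivative has mean zero, so
    the constant \<open>c\<close> contributes nothing.\<close>
  have "(LINT x|leb01. deriv \<phi> x) = (LINT x|leb01. indicator {0<..<1} x * deriv \<phi> x)"
    by (rule Bochner_Integration.integral_cong) auto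
  also have "\<dots> = 0"
    using integral_deriv_test_function[OF \<phi>, of 0] test_function_imp_0[OF \<phi>, of 0] by simp
  finally have 2: "(LINT x|leb01. deriv \<phi> x) = 0" .
  \<comment> \<open>\<open>F\<close> is prescribed only on the open interval, so integrability is
    proved for the indefinite integral and then transferred.\<close>
  have "continuous_on {0..1} (\<lambda>x. integral {0..x} f)"
    by (intro indefinite_integral_continuous_1 integrable_leb01_imp_integrable_on f)
  then have "integrable leb01 (\<lambda>x. integral {0..x} f * deriv \<phi> x)"
    by (intro square_integrable_mult square_integrable_continuous_on
        square_integrable_test_function test_function_deriv \<phi>)
  then have 3: "integrable leb01 (\<lambda>x. (F x - c) * deriv \<phi> x)"
    by (rule Bochner_Integration.integrable_cong[THEN iffD1, rotated -1]) (auto simp: F)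
  have "(LINT x|leb01. F x * deriv \<phi> x) = (LINT x|leb01. (F x - c) * deriv \<phi> x + c * deriv \<phi> x)"
    by (simp add: algebra_simps)
  also have "\<dots> = (LINT x|leb01. (F x - c) * deriv \<phi> x) + c * (LINT x|leb01. deriv \<phi> x)"
    using 3 d by simp
  finally show ?thesis
    using 1 2 by simp
qed

lemma ex_weak_primitive:
  fixes q :: l2
  shows "\<exists>p. has_weak_deriv p q \<and> has_value_at p a 0"
  unfolding has_value_at_def
proof transfer
  fix f :: "real \<Rightarrow> real" and a :: real
  assume "l2_rel f f"
  then have f: "integrable leb01 f"
    by (simp add: l2_rel_def square_integrable_imp_integrable)
  \<comment> \<open>The constant of integration is chosen so that \<open>F a = 0\<close>. Being
    continuous, \<open>F\<close> serves as its own continuous representative.\<close>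
  define F where "F x = - integral {0..a} f + integral {0..x} f" for x
  have cont: "continuous_on {0..1} F"
    unfolding F_def
    by (intro continuous_intros indefinite_integral_continuous_1
        integrable_leb01_imp_integrable_on f)
  then have "l2_rel F F"
    by (simp add: l2_rel_def square_integrable_continuous_on)
  moreover have "(LINT x|leb01. F x * deriv \<phi> x) = - (LINT x|leb01. f x * \<phi> x)"
    if "test_function \<phi>" for \<phi>
    by (rule integral_by_parts_test_function[OF f that]) (simp add: F_def)
  moreover have "F a = 0"
    by (simp add: F_def)
  ultimately show "\<exists>p\<in>{p. l2_rel p p}. (\<forall>\<phi>. test_function \<phi> \<longrightarrow>
        (LINT x|leb01. p x * deriv \<phi> x) = - (LINT x|leb01. f x * \<phi> x)) \<and>
      (\<exists>u. (continuous_on {0..1} u \<and> (AE x in leb01. p x = u x)) \<and> u a = 0)"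
    using cont by (intro bexI[of _ F]) auto
qed

lemma surj_D2: "surj D2"
proof (rule surjI)
  fix q
  obtain g where g: "has_weak_deriv g q" "has_value_at g 1 0"
    using ex_weak_primitive by blast
  obtain p where p: "has_weak_deriv p g" "has_value_at p 0 0"
    using ex_weak_primitive by blast
  \<comment> \<open>As \<open>g\<close> is the weak derivative of \<open>p\<close>, its zero at 1 is
    the second boundary condition of \<open>V\<close>.\<close>
  have "p \<in> {p \<in> H2. has_value_at p 0 0 \<and> has_value_at (weak_deriv p) 1 0}"
    using g p by (auto simp: H2_def weak_deriv_eqI)
  then have "D2 (Abs_V p) = q"
    using g p by (simp add: D2_def Abs_V_inverse weak_deriv_eqI)
  \<comment> \<open>The right inverse required by \<open>surjI\<close> is a choice function, and
    \<open>Abs_V p\<close> witnesses that the choice succeeds.\<close>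
  then show "D2 (SOME r. D2 r = q) = q"
    by (rule someI)
qed

theorem proposition9:
  fixes A11 :: "V \<Rightarrow> (V \<Rightarrow>\<^sub>L real)"
    and A12 :: "l2 \<Rightarrow> (V \<Rightarrow>\<^sub>L real)"
    and A21 :: "V \<Rightarrow> l2"
    and A :: "V \<times> l2 \<Rightarrow> (V \<Rightarrow>\<^sub>L real) \<times> l2"
    and W :: "l2 \<Rightarrow> l2"
  assumes A11: "\<And>p1 p2. blinfun_apply (A11 p1) p2 = inner (D2 p1) (D2 p2)"
    and A12: "\<And>q p1. blinfun_apply (A12 q) p1 = inner q (D2 p1)"
    and A21: "\<And>p1 q. inner (A21 p1) q = - inner (D2 p1) q"
    and A: "\<And>p q. A (p, q) = (A11 p + A12 q, A21 p)"
    and W: "W = (\<lambda>q. - A21 (inv A11 (A12 q)))"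
  shows "bounded_linear W \<and> accretive_on UNIV W"
proof -
  have eq: "D2 p = q" if "A11 p = A12 q" for p q
  proof -
    \<comment> \<open>Testing with an \<open>r\<close> whose second derivative is the residual turns
      orthogonality into a vanishing norm.\<close>
    obtain r where r: "D2 r = D2 p - q"
      using surj_D2 by (metis surjD)
    have "inner (D2 p) (D2 r) = inner q (D2 r)"
      using that A11 A12 by metis
    then have "inner (D2 p - q) (D2 p - q) = 0"
      by (simp add: r inner_diff_left)
    then show ?thesis by simp
  qed
  have A21': "A21 p = - D2 p" for p
    by (rule vector_eq_rdot[THEN iffD1]) (simp add: A21)
  have "W q = q" for q
  proof -
    obtain p where "D2 p = q"
      using surj_D2 by (metis surjD)
    then have "A11 p = A12 q"
      by (intro blinfun_eqI) (simp add: A11 A12)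
    \<comment> \<open>\<open>inv\<close> returns a preimage once \<open>A12 q\<close> is known to
      lie in the range of \<open>A11\<close>, which \<open>p\<close> witnesses; \<open>eq\<close>
      then gives the second derivative of that preimage.\<close>
    then have "A11 (inv A11 (A12 q)) = A12 q"
      by (rule f_inv_into_f[OF range_eqI[OF sym]])
    then show ?thesis
      \<comment> \<open>The minus sign of the Schur complement cancels the one in
        \<open>A21\<close>, which fixes the sign needed for accretivity.\<close>
      by (simp add: W A21' eq)
  qed
  then have "W = (\<lambda>q. q)" ..
  then show ?thesis
    by (simp add: bounded_linear_ident accretive_on_def)
qed

end
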